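(* For any field $\mathbb{F}$ of characteristic $0$, the first Weyl algebra $$A_1(\mathbb{F})=\mathbb{F}\langle x,y\rangle/(yx-xy-1)$$ is not weakly left Jacobson.
   Context: All rings and algebras are associative and unital. $\mathbb{F}\langle x,y\rangle$ is the free $\mathbb{F}$-algebra on $x,y$. A left ideal $I$ of a ring $\mathbb{A}$ is prime if for all $a,b\in\mathbb{A}$ with $a\mathbb{A}b\subseteq I$ we have $a\in I$ or $b\in I$. A ring is weakly left Jacobson if every prime left ideal is an intersection of maximal left ideals (the empty intersection being the whole ring). *)

theory Defs
  imports "HOL-Algebra.QuotRing"
begin

definition left_ideal :: "'r set \<Rightarrow> ('r, 'm) ring_scheme \<Rightarrow> bool" where
  "left_ideal I R \<longleftrightarrow>
     additive_subgroup I R \<and> (\<forall>r\<in>carrier R. \<forall>a\<in>I. r \<otimes>\<^bsub>R\<^esub> a \<in> I)"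

text \<open>Properness is not required here: the whole ring is a prime left ideal.\<close>

definition prime_left_ideal :: "'r set \<Rightarrow> ('r, 'm) ring_scheme \<Rightarrow> bool" where
  "prime_left_ideal I R \<longleftrightarrow>
     left_ideal I R \<and>
     (\<forall>a\<in>carrier R. \<forall>b\<in>carrier R.
        (\<forall>r\<in>carrier R. a \<otimes>\<^bsub>R\<^esub> r \<otimes>\<^bsub>R\<^esub> b \<in> I) \<longrightarrow> a \<in> I \<or> b \<in> I)"

definition maximal_left_ideal :: "'r set \<Rightarrow> ('r, 'm) ring_scheme \<Rightarrow> bool" where
  "maximal_left_ideal M R \<longleftrightarrow>
     left_ideal M R \<and> M \<noteq> carrier R \<and>
     (\<forall>J. left_ideal J R \<longrightarrow> M \<subseteq> J \<longrightarrow> J = M \<or> J = carrier R)"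

text \<open>Intersecting with the carrier makes the empty intersection the whole ring
  rather than \<^term>\<open>UNIV\<close>.\<close>

definition weakly_left_jacobson :: "('r, 'm) ring_scheme \<Rightarrow> bool" where
  "weakly_left_jacobson R \<longleftrightarrow>
     (\<forall>P. prime_left_ideal P R \<longrightarrow>
        (\<exists>\<M>. (\<forall>M\<in>\<M>. maximal_left_ideal M R) \<and> P = carrier R \<inter> \<Inter>\<M>))"

text \<open>Words in the generators \<^typ>\<open>'g\<close> are lists; an element of the free algebra is the
  finitely supported function sending each word to its coefficient.\<close>

definition free_algebra :: "('g list \<Rightarrow> 'a::field) ring" where
  "free_algebra =
     \<lparr>carrier = {f. finite {w. f w \<noteq> 0}},
      mult = (\<lambda>f g w. \<Sum>(u, v) | u @ v = w. f u * g v),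
      one = (\<lambda>w. if w = [] then 1 else 0),
      zero = (\<lambda>w. 0),
      add = (\<lambda>f g w. f w + g w)\<rparr>"

definition free_gen :: "'g \<Rightarrow> 'g list \<Rightarrow> 'a::field" where
  "free_gen g = (\<lambda>w. if w = [g] then 1 else 0)"

lemma finite_splits: "finite {(u, v). u @ v = w}"
proof (rule finite_subset)
  show "{(u, v). u @ v = w} \<subseteq> (\<lambda>n. (take n w, drop n w)) ` {..length w}"
  proof clarify
    fix u v :: "'a list"
    show "(u, v) \<in> (\<lambda>n. (take n (u @ v), drop n (u @ v))) ` {..length (u @ v)}"
      by (rule image_eqI[of _ _ "length u"]) auto
  qed
qed simp

lemma free_gen_closed: "free_gen g \<in> carrier free_algebra"
  by (auto simp: free_gen_def free_algebra_def)

lemma free_algebra_mult_closed: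
  fixes f g :: "'g list \<Rightarrow> 'a::field"
  assumes "finite {w. f w \<noteq> 0}" "finite {w. g w \<noteq> 0}"
  shows "finite {w. (\<Sum>(u, v) | u @ v = w. f u * g v) \<noteq> 0}"
proof (rule finite_subset)
  show "finite ((\<lambda>(u, v). u @ v) ` ({w. f w \<noteq> 0} \<times> {w. g w \<noteq> 0}))"
    using assms by blast
  show "{w. (\<Sum>(u, v) | u @ v = w. f u * g v) \<noteq> 0} \<subseteq>
        (\<lambda>(u, v). u @ v) ` ({w. f w \<noteq> 0} \<times> {w. g w \<noteq> 0})"
  proof
    fix w assume "w \<in> {w. (\<Sum>(u, v) | u @ v = w. f u * g v) \<noteq> 0}"
    then have "(\<Sum>(u, v) | u @ v = w. f u * g v) \<noteq> 0" by simp
    then obtain p where "p \<in> {(u, v). u @ v = w}" "(case p of (u, v) \<Rightarrow> f u * g v) \<noteq> 0"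
      by (rule sum.not_neutral_contains_not_neutral)
    then show "w \<in> (\<lambda>(u, v). u @ v) ` ({w. f w \<noteq> 0} \<times> {w. g w \<noteq> 0})"
      by (intro image_eqI[of _ _ p]) auto
  qed
qed

lemma free_algebra_mult_assoc:
  fixes f g h :: "'g list \<Rightarrow> 'a::field"
  shows "(\<Sum>(u, v) | u @ v = w. (\<Sum>(s, t) | s @ t = u. f s * g t) * h v) =
         (\<Sum>(u, v) | u @ v = w. f u * (\<Sum>(s, t) | s @ t = v. g s * h t))"
proof -
  have "(\<Sum>(u, v) | u @ v = w. (\<Sum>(s, t) | s @ t = u. f s * g t) * h v) =
        (\<Sum>p\<in>{(u, v). u @ v = w}. \<Sum>q\<in>{(s, t). s @ t = fst p}. f (fst q) * g (snd q) * h (snd p))"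
    by (simp add: sum_distrib_right case_prod_beta)
  also have "\<dots> = (\<Sum>(p, q)\<in>(SIGMA p:{(u, v). u @ v = w}. {(s, t). s @ t = fst p}).
                     f (fst q) * g (snd q) * h (snd p))"
    by (rule sum.Sigma) (auto simp: finite_splits)
  also have "\<dots> = (\<Sum>(p, q)\<in>(SIGMA p:{(u, v). u @ v = w}. {(s, t). s @ t = snd p}).
                     f (fst p) * (g (fst q) * h (snd q)))"
    by (rule sum.reindex_bij_witness
          [where j = "\<lambda>(p, q). ((fst q, snd q @ snd p), (snd q, snd p))"
             and i = "\<lambda>(p, q). ((fst p @ fst q, snd q), (fst p, fst q))"])
       (auto simp: mult.assoc)
  also have "\<dots> = (\<Sum>p\<in>{(u, v). u @ v = w}. \<Sum>q\<in>{(s, t). s @ t = snd p}.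
                     f (fst p) * (g (fst q) * h (snd q)))"
    by (rule sum.Sigma[symmetric]) (auto simp: finite_splits)
  also have "\<dots> = (\<Sum>(u, v) | u @ v = w. f u * (\<Sum>(s, t) | s @ t = v. g s * h t))"
    by (simp add: sum_distrib_left case_prod_beta)
  finally show ?thesis .
qed

lemma ring_free_algebra: "ring (free_algebra :: ('g list \<Rightarrow> 'a::field) ring)"
proof (rule ringI)
  let ?R = "free_algebra :: ('g list \<Rightarrow> 'a) ring"
  have add_closed: "finite {w. f w + g w \<noteq> 0}"
    if "finite {w. f w \<noteq> 0}" "finite {w. g w \<noteq> 0}" for f g :: "'g list \<Rightarrow> 'a"
    by (rule finite_subset[of _ "{w. f w \<noteq> 0} \<union> {w. g w \<noteq> 0}"]) (use that in auto)
  show "abelian_group ?R"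
  proof (rule abelian_groupI)
    fix f assume f: "f \<in> carrier ?R"
    show "\<exists>g\<in>carrier ?R. g \<oplus>\<^bsub>?R\<^esub> f = \<zero>\<^bsub>?R\<^esub>"
      using f by (intro bexI[of _ "\<lambda>w. - f w"]) (auto simp: free_algebra_def)
  qed (auto simp: free_algebra_def add_closed add.assoc add.commute)
  show "monoid ?R"
  proof (rule monoidI)
    fix f assume f: "f \<in> carrier ?R"
    have "(\<Sum>(u, v) | u @ v = w. (if u = [] then 1 else 0) * f v) = f w" for w
    proof -
      have "(\<Sum>(u, v) | u @ v = w. (if u = [] then 1 else 0) * f v) =
            (\<Sum>p\<in>{([] :: 'g list, w)}. f (snd p))"
        by (rule sum.mono_neutral_cong_right) (auto simp: finite_splits split: if_splits)
      then show ?thesis by simp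
    qed
    then show "\<one>\<^bsub>?R\<^esub> \<otimes>\<^bsub>?R\<^esub> f = f"
      by (simp add: free_algebra_def)
    have "(\<Sum>(u, v) | u @ v = w. f u * (if v = [] then 1 else 0)) = f w" for w
    proof -
      have "(\<Sum>(u, v) | u @ v = w. f u * (if v = [] then 1 else 0)) =
            (\<Sum>p\<in>{(w, [] :: 'g list)}. f (fst p))"
        by (rule sum.mono_neutral_cong_right) (auto simp: finite_splits split: if_splits)
      then show ?thesis by simp
    qed
    then show "f \<otimes>\<^bsub>?R\<^esub> \<one>\<^bsub>?R\<^esub> = f"
      by (simp add: free_algebra_def)
  qed (simp_all add: free_algebra_def free_algebra_mult_closed free_algebra_mult_assoc)
qed (simp_all add: free_algebra_def fun_eq_iff case_prod_beta distrib_left distrib_right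
       sum.distrib)

datatype weyl_gen = Gen_x | Gen_y

definition weyl_relation :: "weyl_gen list \<Rightarrow> 'a::field" where
  "weyl_relation =
     free_gen Gen_y \<otimes>\<^bsub>free_algebra\<^esub> free_gen Gen_x
       \<ominus>\<^bsub>free_algebra\<^esub> free_gen Gen_x \<otimes>\<^bsub>free_algebra\<^esub> free_gen Gen_y
       \<ominus>\<^bsub>free_algebra\<^esub> \<one>\<^bsub>free_algebra\<^esub>"

definition weyl_algebra :: "(weyl_gen list \<Rightarrow> 'a::field) set ring" where
  "weyl_algebra = free_algebra Quot (Idl\<^bsub>free_algebra\<^esub> {weyl_relation})"

lemma weyl_relation_closed: "weyl_relation \<in> carrier free_algebra"
proof -
  interpret ring "free_algebra :: (weyl_gen list \<Rightarrow> 'a) ring" by (rule ring_free_algebra)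
  show ?thesis by (simp add: weyl_relation_def free_gen_closed)
qed

lemma ring_weyl_algebra: "ring weyl_algebra"
proof -
  interpret ring "free_algebra :: (weyl_gen list \<Rightarrow> 'a) ring" by (rule ring_free_algebra)
  show ?thesis
    unfolding weyl_algebra_def
    by (rule ideal.quotient_is_ring[OF genideal_ideal]) (simp add: weyl_relation_closed)
qed

end

theory Submission
  imports Defs "HOL-Computational_Algebra.Polynomial"
begin

text \<open>The Weyl algebra \<open>A\<close> is simple, and in a simple ring every left ideal \<open>I\<close> is prime: if
  \<open>a \<noteq> 0\<close> and \<open>aAb \<subseteq> I\<close>, then \<open>Ab = AaAb \<subseteq> I\<close>. So it is enough to find a left ideal that is not
  an intersection of maximal ones. Let \<open>I = A(yx)\<close>, the annihilator of \<open>x\<^sup>-\<^sup>1\<close> in the module of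
  Laurent polynomials. This module is a non-split extension of the simple module \<open>A/Ax\<close> by the
  simple module of polynomials, so \<open>Ax\<close> is the only maximal left ideal above \<open>I\<close>, and \<open>I\<close> does not
  contain \<open>x\<close>. Only the inclusion \<open>x \<in> M\<close> is needed for maximal \<open>M \<supseteq> I\<close>: otherwise
  \<open>A = M + Ax\<close>, and modulo \<open>Ayx\<close> this puts some \<open>1 + x p(x)\<close> into \<open>M\<close>, from which the operator
  \<open>yx\<close> extracts the constant term.\<close>

subsection \<open>Rings generated by a Weyl pair\<close>

text \<open>Isolates the algebra from the cosets: \<open>c\<close> embeds the scalars, and
  \<open>generated\<close> is structural induction, every word arising from a scalar by left
  multiplication with generators. The zero ring is a model too; nontriviality enters only through
  the assumption of \<open>not_weakly_left_jacobson\<close>.\<close>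

locale weyl_ring = ring A for A (structure) +
  fixes c :: "'k::field_char_0 \<Rightarrow> 'a" and x y :: 'a
  assumes c_closed [simp, intro]: "c k \<in> carrier A"
    and x_closed [simp, intro]: "x \<in> carrier A"
    and y_closed [simp, intro]: "y \<in> carrier A"
    and c_add: "c (k + l) = c k \<oplus> c l"
    and c_mult: "c (k * l) = c k \<otimes> c l"
    and c_one: "c 1 = \<one>"
    and c_central: "a \<in> carrier A \<Longrightarrow> c k \<otimes> a = a \<otimes> c k"
    and yx_eq: "y \<otimes> x = x \<otimes> y \<oplus> \<one>"
    and generated: "\<lbrakk>\<And>k. c k \<in> S; \<And>a b. a \<in> S \<Longrightarrow> b \<in> S \<Longrightarrow> a \<oplus> b \<in> S;
          \<And>a. a \<in> S \<Longrightarrow> x \<otimes> a \<in> S; \<And>a. a \<in> S \<Longrightarrow> y \<otimes> a \<in> S\<rbrakk> \<Longrightarrow> carrier A \<subseteq> S"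
begin

lemma c_zero: "c 0 = \<zero>"
  using c_add[of 0 0] by (metis add.r_cancel_one' add_0 c_closed)

lemma add_minus_cancel: "a \<in> carrier A \<Longrightarrow> b \<in> carrier A \<Longrightarrow> a \<oplus> b \<ominus> a = b"
  using a_comm[of a b] by (simp add: a_minus_def a_assoc r_neg)

section \<open>Polynomials in \<open>x\<close>\<close>

definition xpoly :: "'k poly \<Rightarrow> 'a" where
  "xpoly p = fold_coeffs (\<lambda>k r. c k \<oplus> x \<otimes> r) p \<zero>"

lemma xpoly_0 [simp]: "xpoly 0 = \<zero>"
  by (simp add: xpoly_def)

lemma xpoly_pCons [simp]: "xpoly (pCons k p) = c k \<oplus> x \<otimes> xpoly p"
\<comment> \<open>\<open>pCons 0 0\<close> is the zero polynomial, on which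
  \<open>fold_coeffs\<close> takes no step; there the equation rests on
  \<open>c_zero\<close>.\<close>
proof (cases "p = 0 \<and> k = 0")
  case True
  then show ?thesis by (simp add: c_zero)
next
  case False
  then show ?thesis by (auto simp: xpoly_def)
qed

lemma xpoly_closed [simp, intro]: "xpoly p \<in> carrier A"
  by (induction p) auto

lemma xpoly_add: "xpoly (p + q) = xpoly p \<oplus> xpoly q"
proof (induction p q rule: poly_induct2)
  case (pCons k p l q)
  have "xpoly (pCons k p + pCons l q) = (c k \<oplus> c l) \<oplus> x \<otimes> (xpoly p \<oplus> xpoly q)"
    using pCons by (simp add: c_add)
  also have "\<dots> = xpoly (pCons k p) \<oplus> xpoly (pCons l q)"
    by (simp add: r_distr a_ac)
  finally show ?case .
qed simp

lemma xpoly_smult: "xpoly (smult k p) = c k \<otimes> xpoly p"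
proof (induction p)
  case (pCons l p)
  have "c k \<otimes> (x \<otimes> xpoly p) = x \<otimes> (c k \<otimes> xpoly p)"
    by (metis c_central c_closed m_assoc x_closed xpoly_closed)
  then show ?case
    using pCons by (simp add: c_mult r_distr)
qed simp

lemma xpoly_commute: "xpoly p \<otimes> x = x \<otimes> xpoly p"
proof (induction p)
  case (pCons k p)
  then show ?case
    by (simp add: l_distr r_distr c_central m_assoc)
qed simp

text \<open>The bracket \<open>[y, -]\<close> is a derivation that kills scalars and sends
  \<open>x\<close> to \<open>\<one>\<close>, so it differentiates polynomials in \<open>x\<close>;
  the induction step is the product rule.\<close>

lemma y_xpoly: "y \<otimes> xpoly p = xpoly p \<otimes> y \<oplus> xpoly (pderiv p)"
proof (induction p)
  case (pCons k p)
  have "y \<otimes> (x \<otimes> xpoly p) = (x \<otimes> y \<oplus> \<one>) \<otimes> xpoly p"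
    by (simp add: m_assoc[symmetric] yx_eq)
  also have "\<dots> = x \<otimes> (xpoly p \<otimes> y \<oplus> xpoly (pderiv p)) \<oplus> xpoly p"
    using pCons by (simp add: l_distr m_assoc)
  also have "\<dots> = (x \<otimes> xpoly p) \<otimes> y \<oplus> (xpoly p \<oplus> x \<otimes> xpoly (pderiv p))"
    by (simp add: r_distr m_assoc a_ac)
  finally show ?case
    by (simp add: pderiv_pCons xpoly_add c_zero r_distr l_distr c_central a_assoc)
qed (simp add: pderiv_0)

section \<open>Normal forms\<close>

text \<open>The sum of \<open>p_j(x) y^j\<close>: the outer variable stands for \<open>y\<close>,
  and the coefficients, polynomials in \<open>x\<close>, are written to the left of its
  powers.\<close>

definition normal_form :: "'k poly poly \<Rightarrow> 'a" where
  "normal_form P = fold_coeffs (\<lambda>p r. xpoly p \<oplus> r \<otimes> y) P \<zero>"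

lemma normal_form_0 [simp]: "normal_form 0 = \<zero>"
  by (simp add: normal_form_def)

lemma normal_form_pCons [simp]: "normal_form (pCons p P) = xpoly p \<oplus> normal_form P \<otimes> y"
proof (cases "P = 0 \<and> p = 0")
  case False
  then show ?thesis by (auto simp: normal_form_def)
qed simp

lemma normal_form_closed [simp, intro]: "normal_form P \<in> carrier A"
  by (induction P) auto

lemma normal_form_add: "normal_form (P + Q) = normal_form P \<oplus> normal_form Q"
proof (induction P Q rule: poly_induct2)
  case (pCons p P q Q)
  have "normal_form (pCons p P + pCons q Q) =
      (xpoly p \<oplus> xpoly q) \<oplus> (normal_form P \<oplus> normal_form Q) \<otimes> y"
    using pCons by (simp add: xpoly_add)
  then show ?case
    by (simp add: l_distr a_ac)
qed simp

lemma x_normal_form: "x \<otimes> normal_form P = normal_form (smult [:0, 1:] P)"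
proof (induction P)
  case (pCons p P)
  then show ?case
    by (simp add: r_distr m_assoc[symmetric] c_zero)
qed simp

text \<open>The bracket \<open>[-, x]\<close> kills \<open>x\<close> and sends \<open>y\<close> to
  \<open>\<one>\<close>, so it is differentiation in the outer variable.\<close>

lemma normal_form_x: "normal_form P \<otimes> x = x \<otimes> normal_form P \<oplus> normal_form (pderiv P)"
proof (induction P)
  case (pCons p P)
  have "normal_form P \<otimes> y \<otimes> x = normal_form P \<otimes> (x \<otimes> y \<oplus> \<one>)"
    by (simp add: m_assoc yx_eq)
  also have "\<dots> = (normal_form P \<otimes> x) \<otimes> y \<oplus> normal_form P"
    by (simp add: r_distr m_assoc)
  also have "\<dots> = x \<otimes> (normal_form P \<otimes> y) \<oplus> (normal_form P \<oplus> normal_form (pderiv P) \<otimes> y)"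
    unfolding pCons.IH by (simp add: l_distr m_assoc a_ac)
  finally show ?case
    by (simp add: pderiv_pCons normal_form_add l_distr r_distr xpoly_commute a_assoc)
qed (simp add: pderiv_0)

text \<open>The bracket \<open>[y, -]\<close> kills \<open>y\<close>, so it acts on the coefficients
  alone, by \<open>y_xpoly\<close>.\<close>

lemma y_normal_form:
  "y \<otimes> normal_form P = normal_form P \<otimes> y \<oplus> normal_form (map_poly pderiv P)"
proof (induction P)
  case (pCons p P)
  have "y \<otimes> normal_form (pCons p P) = y \<otimes> xpoly p \<oplus> (y \<otimes> normal_form P) \<otimes> y"
    by (simp add: r_distr m_assoc)
  also have "\<dots> = normal_form (pCons p P) \<otimes> y \<oplus>
      (xpoly (pderiv p) \<oplus> normal_form (map_poly pderiv P) \<otimes> y)"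
    unfolding pCons.IH y_xpoly by (simp add: l_distr a_ac)
  also have "map_poly pderiv (pCons p P) = pCons (pderiv p) (map_poly pderiv P)"
    by (simp add: map_poly_pCons pderiv_0)
  ultimately show ?case
    by (simp only: normal_form_pCons)
qed simp

text \<open>The spanning half of the Poincare-Birkhoff-Witt theorem: normal forms contain the
  scalars and are stable under sums and left multiplication by \<open>x\<close> and
  \<open>y\<close>.\<close>

lemma normal_form_surj:
  assumes "a \<in> carrier A"
  obtains P where "a = normal_form P"
proof -
  have "carrier A \<subseteq> range normal_form"
  proof (rule generated)
    fix k
    have "c k = normal_form [:[:k:]:]" by simp
    then show "c k \<in> range normal_form" by blast
  next
    fix a b assume "a \<in> range normal_form" "b \<in> range normal_form"
    then show "a \<oplus> b \<in> range normal_form"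
      by (auto simp: normal_form_add[symmetric])
  next
    fix a assume "a \<in> range normal_form"
    then obtain P where a: "a = normal_form P" by blast
    show "x \<otimes> a \<in> range normal_form"
      unfolding a x_normal_form by blast
    have "y \<otimes> a = normal_form (pCons 0 P + map_poly pderiv P)"
      unfolding a y_normal_form by (simp add: normal_form_add)
    then show "y \<otimes> a \<in> range normal_form" by blast
  qed
  with assms that show thesis by blast
qed

text \<open>Commutators with \<open>x\<close> and \<open>y\<close> act on normal forms as the two partial derivatives, so in
  characteristic 0 they bring any nonzero normal form down to a nonzero scalar.\<close>

lemma one_in_ideal_const:
  assumes J: "ideal J A" and "normal_form [:p:] \<in> J" "p \<noteq> 0"
  shows "\<one> \<in> J"
  using assms(2,3)
proof (induction "degree p" arbitrary: p rule: less_induct)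
  case less
  interpret ideal J A by (rule J)
  show ?case
  proof (cases "degree p = 0")
    case True
    then obtain k where p: "p = [:k:]" by (rule degree_eq_zeroE)
    with less.prems have k: "k \<noteq> 0" "c k \<in> J" by auto
    then have "c (inverse k) \<otimes> c k \<in> J" by (simp add: I_l_closed)
    with k show ?thesis by (simp flip: c_mult add: c_one)
  next
    case False
    have p: "xpoly p \<in> J" using less.prems by simp
    have "xpoly (pderiv p) = y \<otimes> xpoly p \<ominus> xpoly p \<otimes> y"
      unfolding y_xpoly by (simp add: add_minus_cancel)
    also have "\<dots> \<in> J"
      using p by (simp add: a_minus_def I_l_closed I_r_closed)
    finally have "normal_form [:pderiv p:] \<in> J" by simp
    \<comment> \<open>Characteristic 0 enters here: a polynomial of positive degree has nonzero
      derivative.\<close>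
    moreover have "pderiv p \<noteq> 0" "degree (pderiv p) < degree p"
      using False by (auto simp: pderiv_eq_0_iff degree_pderiv)
    ultimately show ?thesis using less.hyps by blast
  qed
qed

text \<open>Brackets with \<open>x\<close> lower the degree in \<open>y\<close> until a nonzero
  polynomial in \<open>x\<close> alone remains, which \<open>one_in_ideal_const\<close>
  handles.\<close>

lemma one_in_ideal:
  assumes J: "ideal J A" and "normal_form P \<in> J" "P \<noteq> 0"
  shows "\<one> \<in> J"
  using assms(2,3)
proof (induction "degree P" arbitrary: P rule: less_induct)
  case less
  interpret ideal J A by (rule J)
  show ?case
  proof (cases "degree P = 0")
    case True
    then obtain p where "P = [:p:]" by (rule degree_eq_zeroE)
    with less.prems show ?thesis using one_in_ideal_const[OF J, of p] by auto
  next
    case False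
    have "normal_form (pderiv P) = normal_form P \<otimes> x \<ominus> x \<otimes> normal_form P"
      unfolding normal_form_x by (simp add: add_minus_cancel)
    also have "\<dots> \<in> J"
      using less.prems by (simp add: a_minus_def I_l_closed I_r_closed)
    finally have "normal_form (pderiv P) \<in> J" .
    moreover have "pderiv P \<noteq> 0" "degree (pderiv P) < degree P"
      using False by (auto simp: pderiv_eq_0_iff degree_pderiv)
    ultimately show ?thesis using less.hyps by blast
  qed
qed

section \<open>Prime left ideals, and maximal left ideals containing \<open>yx\<close>\<close>

lemma left_ideal_prime:
  assumes I: "left_ideal I A"
  shows "prime_left_ideal I A"
  unfolding prime_left_ideal_def
proof (intro conjI ballI impI I)
  fix a b assume a: "a \<in> carrier A" and b: "b \<in> carrier A"
    and ab: "\<forall>r\<in>carrier A. a \<otimes> r \<otimes> b \<in> I"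
  interpret additive_subgroup I A using I by (simp add: left_ideal_def)
  have l: "r \<otimes> i \<in> I" if "r \<in> carrier A" "i \<in> I" for r i
    using I that by (simp add: left_ideal_def)
  \<comment> \<open>\<open>J\<close> contains \<open>a\<close> by assumption. It absorbs left
    factors because \<open>I\<close> does, and right factors because \<open>s\<close> ranges over
    all of \<open>A\<close>. A nonzero normal form of \<open>a\<close> thus puts
    \<open>\<one>\<close> into \<open>J\<close>, which means \<open>b\<close> lies in
    \<open>I\<close>.\<close>
  define J where "J = {r \<in> carrier A. \<forall>s\<in>carrier A. r \<otimes> s \<otimes> b \<in> I}"
  have J: "ideal J A"
  proof (rule idealI)
    show "ring A" by (rule ring_axioms)
    show "subgroup J (add_monoid A)"
    proof (rule add.subgroupI)
      show "J \<noteq> {}" using b by (auto simp: J_def intro!: exI[of _ \<zero>])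
    next
      fix r assume r: "r \<in> J"
      have "\<ominus> r \<otimes> s \<otimes> b = \<ominus> (r \<otimes> s \<otimes> b)" if "s \<in> carrier A" for s
        using that r b by (simp add: J_def l_minus)
      then show "\<ominus> r \<in> J" using r by (simp add: J_def)
    next
      fix r r' assume "r \<in> J" "r' \<in> J"
      then show "r \<oplus> r' \<in> J" using b by (auto simp: J_def l_distr)
    qed (auto simp: J_def)
  next
    fix r t assume r: "r \<in> J" and t: "t \<in> carrier A"
    then show "t \<otimes> r \<in> J"
      using b l by (auto simp: J_def m_assoc)
    have "r \<otimes> t \<otimes> s \<otimes> b = r \<otimes> (t \<otimes> s) \<otimes> b" if "s \<in> carrier A" for s
      using that r t b by (simp add: J_def m_assoc)
    then show "r \<otimes> t \<in> J"
      using r t by (simp add: J_def)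
  qed
  obtain P where P: "a = normal_form P" using a by (rule normal_form_surj)
  show "a \<in> I \<or> b \<in> I"
  proof (cases "P = 0")
    case True
    then show ?thesis using P by simp
  next
    case False
    have "normal_form P \<in> J" using P a ab by (simp add: J_def)
    then have "\<one> \<in> J" using one_in_ideal[OF J] False by blast
    then have "\<one> \<otimes> \<one> \<otimes> b \<in> I" unfolding J_def by blast
    then show ?thesis using b by simp
  qed
qed

text \<open>The powers \<open>x\<^sup>k\<close> are eigenvectors of \<open>yx\<close> modulo \<open>M\<close>, with eigenvalue \<open>k\<close>; applying
  \<open>yx - deg q\<close> therefore lowers the degree of \<open>q\<close> and keeps its constant term nonzero.\<close>

lemma one_in_left_ideal:
  assumes M: "left_ideal M A" and yx: "y \<otimes> x \<in> M"
    and "xpoly q \<in> M" "coeff q 0 \<noteq> 0"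
  shows "\<one> \<in> M"
  using assms(3,4)
proof (induction "degree q" arbitrary: q rule: less_induct)
  case less
  interpret additive_subgroup M A using M by (simp add: left_ideal_def)
  have l: "r \<otimes> i \<in> M" if "r \<in> carrier A" "i \<in> M" for r i
    using M that by (simp add: left_ideal_def)
  show ?case
  proof (cases "degree q = 0")
    case True
    then obtain k where p: "q = [:k:]" by (rule degree_eq_zeroE)
    with less.prems have k: "k \<noteq> 0" "c k \<in> M" by auto
    then have "c (inverse k) \<otimes> c k \<in> M" by (simp add: l)
    with k show ?thesis by (simp flip: c_mult add: c_one)
  next
    case False
    have "(y \<otimes> x) \<otimes> xpoly q = (y \<otimes> xpoly q) \<otimes> x"
      by (simp add: m_assoc xpoly_commute)
    also have "\<dots> = xpoly q \<otimes> (y \<otimes> x) \<oplus> xpoly (pCons 0 (pderiv q))"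
      unfolding y_xpoly by (simp add: l_distr m_assoc xpoly_commute c_zero)
    \<comment> \<open>The bracket of \<open>yx\<close> with \<open>q(x)\<close> is
      \<open>x q'(x)\<close>, the Euler operator applied to \<open>q\<close>.\<close>
    finally have "xpoly (pCons 0 (pderiv q)) =
        (y \<otimes> x) \<otimes> xpoly q \<ominus> xpoly q \<otimes> (y \<otimes> x)"
      by (simp add: add_minus_cancel)
    also have "\<dots> \<in> M"
      using less.prems yx by (simp add: a_minus_def l)
    finally have *: "xpoly (pCons 0 (pderiv q)) \<in> M" .
    \<comment> \<open>The coefficient of \<open>r\<close> at \<open>k\<close> is
      \<open>degree q - k\<close> times that of \<open>q\<close>: the top one cancels, and the
      constant one is multiplied by \<open>degree q\<close>, nonzero in characteristic 0.\<close>
    define r where "r = smult (of_nat (degree q)) q + smult (- 1) (pCons 0 (pderiv q))"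
    have "xpoly r \<in> M"
      unfolding r_def xpoly_add xpoly_smult using * less.prems by (intro a_closed l) auto
    moreover have "coeff r 0 \<noteq> 0" using False less.prems by (simp add: r_def)
    moreover have "degree r < degree q"
    proof (rule degree_lessI)
      show "r \<noteq> 0 \<or> 0 < degree q" using False by simp
      show "\<forall>k\<ge>degree q. coeff r k = 0"
      proof (intro allI impI)
        fix k assume "degree q \<le> k"
        then show "coeff r k = 0"
          using False by (cases "k = degree q")
            (auto simp: r_def coeff_pCons coeff_pderiv coeff_eq_0 split: nat.splits)
      qed
    qed
    ultimately show ?thesis using less.hyps by blast
  qed
qed

lemma x_in_maximal_left_ideal:
  assumes M: "maximal_left_ideal M A" and yx: "y \<otimes> x \<in> M"
  shows "x \<in> M"
proof (rule ccontr)
  assume x: "x \<notin> M"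
  have lM: "left_ideal M A" using M by (simp add: maximal_left_ideal_def)
  interpret additive_subgroup M A using lM by (simp add: left_ideal_def)
  have l: "r \<otimes> i \<in> M" if "r \<in> carrier A" "i \<in> M" for r i
    using lM that by (simp add: left_ideal_def)
  have [simp]: "m \<in> carrier A" if "m \<in> M" for m using that by (rule a_Hcarr)
  \<comment> \<open>\<open>N\<close> is \<open>M + Ax\<close>; it properly contains
    \<open>M\<close>, so maximality makes it all of \<open>A\<close>.\<close>
  define N where "N = {m \<oplus> a \<otimes> x | m a. m \<in> M \<and> a \<in> carrier A}"
  have NI: "m \<oplus> a \<otimes> x \<in> N" if "m \<in> M" "a \<in> carrier A" for m a
    using that by (auto simp: N_def)
  have "left_ideal N A"
    unfolding left_ideal_def
  proof (intro conjI ballI)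
    show "additive_subgroup N A"
    proof (rule additive_subgroupI, rule add.subgroupI)
      show "N \<subseteq> carrier A" by (auto simp: N_def)
      show "N \<noteq> {}" using NI[OF zero_closed] by blast
    next
      fix n assume "n \<in> N"
      then obtain m a where n: "n = m \<oplus> a \<otimes> x" "m \<in> M" "a \<in> carrier A"
        by (auto simp: N_def)
      then have "\<ominus> n = \<ominus> m \<oplus> (\<ominus> a) \<otimes> x" by (simp add: minus_add l_minus)
      then show "\<ominus> n \<in> N" using n by (simp add: NI)
    next
      fix n n' assume "n \<in> N" "n' \<in> N"
      then obtain m a m' a' where n: "n = m \<oplus> a \<otimes> x" "m \<in> M" "a \<in> carrier A"
        "n' = m' \<oplus> a' \<otimes> x" "m' \<in> M" "a' \<in> carrier A"
        by (auto simp: N_def)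
      then have "n \<oplus> n' = (m \<oplus> m') \<oplus> (a \<oplus> a') \<otimes> x" by (simp add: l_distr a_ac)
      then show "n \<oplus> n' \<in> N" using n by (simp add: NI)
    qed
  next
    fix r n assume r: "r \<in> carrier A" and "n \<in> N"
    then obtain m a where n: "n = m \<oplus> a \<otimes> x" "m \<in> M" "a \<in> carrier A"
      by (auto simp: N_def)
    then have "r \<otimes> n = r \<otimes> m \<oplus> (r \<otimes> a) \<otimes> x" using r by (simp add: r_distr m_assoc)
    then show "r \<otimes> n \<in> N" using n r by (simp add: NI l)
  qed
  moreover have "M \<subseteq> N"
    using NI[of _ \<zero>] by auto
  moreover have "x \<in> N"
    using NI[of \<zero> \<one>] by simp
  ultimately have "N = carrier A"
    using M x by (auto simp: maximal_left_ideal_def)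
  then have "\<one> \<in> N" by simp
  then obtain m a where m: "\<one> = m \<oplus> a \<otimes> x" "m \<in> M" and a: "a \<in> carrier A"
    by (auto simp: N_def)
  \<comment> \<open>Separating the part of the normal form free of \<open>y\<close> gives
    \<open>- a = p(x) + b y\<close>. Hence \<open>m = 1 - a x = (1 + x p(x)) + b (yx)\<close>, where
    the bracketed polynomial is \<open>pCons 1 p\<close>; since \<open>yx\<close> is in
    \<open>M\<close>, so is that polynomial.\<close>
  obtain P where "\<ominus> a = normal_form P" using a by (auto intro: normal_form_surj)
  moreover obtain p Q where "P = pCons p Q" by (cases P)
  ultimately obtain b where b: "b \<in> carrier A" "\<ominus> a = xpoly p \<oplus> b \<otimes> y" by auto
  have "m = \<one> \<oplus> \<ominus> (a \<otimes> x)"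
    using m a by (simp add: a_assoc r_neg)
  also have "\<dots> = \<one> \<oplus> (xpoly p \<oplus> b \<otimes> y) \<otimes> x"
    using a by (simp add: l_minus[symmetric] b(2))
  also have "\<dots> = xpoly (pCons 1 p) \<oplus> b \<otimes> (y \<otimes> x)"
    using b(1) by (simp add: l_distr m_assoc xpoly_commute c_one a_assoc)
  finally have "xpoly (pCons 1 p) = m \<ominus> b \<otimes> (y \<otimes> x)"
    using b(1) by (simp add: a_minus_def a_assoc r_neg)
  also have "\<dots> \<in> M" using m(2) b(1) yx by (simp add: a_minus_def l)
  finally have "xpoly (pCons 1 p) \<in> M" .
  then have "\<one> \<in> M"
    by (rule one_in_left_ideal[OF lM yx]) simp
  then have "r \<in> M" if "r \<in> carrier A" for r
    using l[OF that, of \<one>] that by simp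
  then have "M = carrier A"
    using a_subset by blast
  then show False using M by (simp add: maximal_left_ideal_def)
qed

text \<open>The assumption says that \<open>x\<close> lies outside \<open>A(yx)\<close>, whereas
  every maximal left ideal above \<open>A(yx)\<close> contains \<open>x\<close>.\<close>

lemma not_weakly_left_jacobson:
  assumes x: "\<And>b. b \<in> carrier A \<Longrightarrow> x \<noteq> b \<otimes> (y \<otimes> x)"
  shows "\<not> weakly_left_jacobson A"
proof
  assume W: "weakly_left_jacobson A"
  define P where "P = (\<lambda>b. b \<otimes> (y \<otimes> x)) ` carrier A"
  have "left_ideal P A"
    unfolding left_ideal_def
  proof (intro conjI ballI)
    show "additive_subgroup P A"
    proof (rule additive_subgroupI, rule add.subgroupI)
      fix n n' assume "n \<in> P" "n' \<in> P"
      then show "n \<oplus> n' \<in> P"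
        by (auto simp: P_def l_distr[symmetric])
    next
      fix n assume "n \<in> P"
      then show "\<ominus> n \<in> P"
        by (auto simp: P_def l_minus[symmetric])
    qed (auto simp: P_def)
  next
    fix r n assume "r \<in> carrier A" "n \<in> P"
    then show "r \<otimes> n \<in> P"
      by (auto simp: P_def m_assoc[symmetric])
  qed
  then have "prime_left_ideal P A" by (rule left_ideal_prime)
  then obtain \<M> where \<M>: "\<forall>M\<in>\<M>. maximal_left_ideal M A" "P = carrier A \<inter> \<Inter>\<M>"
    using W unfolding weakly_left_jacobson_def by blast
  have "y \<otimes> x \<in> P"
    unfolding P_def by (rule image_eqI[of _ _ \<one>]) auto
  \<comment> \<open>This covers an empty \<open>\<M>\<close> as well: \<open>P\<close> would then be
    the whole carrier.\<close>
  then have "x \<in> P"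
    using \<M> x_in_maximal_left_ideal by auto
  then show False using x by (auto simp: P_def)
qed

end

subsection \<open>The free algebra and its action on series\<close>

definition word_monom :: "'a \<Rightarrow> 'g list \<Rightarrow> 'g list \<Rightarrow> 'a::field" where
  "word_monom k u = (\<lambda>w. if w = u then k else 0)"

lemma word_monom_closed [simp, intro]: "word_monom k u \<in> carrier free_algebra"
  by (auto simp: word_monom_def free_algebra_def)

lemma free_gen_eq_word_monom: "free_gen g = word_monom 1 [g]"
  by (simp add: free_gen_def word_monom_def)

lemma free_one_eq_word_monom: "\<one>\<^bsub>free_algebra\<^esub> = word_monom 1 []"
  by (simp add: free_algebra_def word_monom_def)

lemma word_monom_add:
  "word_monom k u \<oplus>\<^bsub>free_algebra\<^esub> word_monom l u = word_monom (k + l) u"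
  by (auto simp: free_algebra_def word_monom_def)

lemma word_monom_mult:
  "word_monom k u \<otimes>\<^bsub>free_algebra\<^esub> word_monom l v = word_monom (k * l) (u @ v)"
proof
  fix w
  have "(\<Sum>(u', v') | u' @ v' = w. word_monom k u u' * word_monom l v v') =
        (\<Sum>p\<in>{(u', v'). u' @ v' = w}. if p = (u, v) then k * l else 0)"
    by (rule sum.cong) (auto simp: word_monom_def split: if_splits)
  also have "\<dots> = word_monom (k * l) (u @ v) w"
    by (auto simp: word_monom_def finite_splits)
  finally show "(word_monom k u \<otimes>\<^bsub>free_algebra\<^esub> word_monom l v) w = word_monom (k * l) (u @ v) w"
    by (simp add: free_algebra_def)
qed

text \<open>Monomials on the empty word are the scalars; this and its right-hand counterpart make
  them central.\<close>

lemma word_monom_Nil_mult_left: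
  fixes f :: "'g list \<Rightarrow> 'a::field"
  shows "word_monom k [] \<otimes>\<^bsub>free_algebra\<^esub> f = (\<lambda>w. k * f w)"
proof
  fix w
  have "(\<Sum>(u, v) | u @ v = w. word_monom k [] u * f v) = (\<Sum>p\<in>{([] :: 'g list, w)}. k * f (snd p))"
    by (rule sum.mono_neutral_cong_right)
      (auto simp: finite_splits word_monom_def split: if_splits)
  then show "(word_monom k [] \<otimes>\<^bsub>free_algebra\<^esub> f) w = k * f w"
    by (simp add: free_algebra_def)
qed

lemma word_monom_Nil_mult_right:
  fixes f :: "'g list \<Rightarrow> 'a::field"
  shows "f \<otimes>\<^bsub>free_algebra\<^esub> word_monom k [] = (\<lambda>w. k * f w)"
proof
  fix w
  have "(\<Sum>(u, v) | u @ v = w. f u * word_monom k [] v) = (\<Sum>p\<in>{(w, [] :: 'g list)}. k * f (fst p))"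
    by (rule sum.mono_neutral_cong_right)
      (auto simp: finite_splits word_monom_def split: if_splits)
  then show "(f \<otimes>\<^bsub>free_algebra\<^esub> word_monom k []) w = k * f w"
    by (simp add: free_algebra_def)
qed

text \<open>Finite support makes every element a finite sum of monomials. The induction runs over a
  finite superset \<open>W\<close> of the support and splits off one word at a time.\<close>

lemma free_algebra_induct [consumes 1, case_names monom add]:
  fixes f :: "'g list \<Rightarrow> 'a::field"
  assumes f: "f \<in> carrier free_algebra"
    and monom: "\<And>k w. Q (word_monom k w)"
    and add: "\<And>f g. \<lbrakk>f \<in> carrier free_algebra; g \<in> carrier free_algebra; Q f; Q g\<rbrakk>
          \<Longrightarrow> Q (f \<oplus>\<^bsub>free_algebra\<^esub> g)"
  shows "Q f"
proof -
  have "Q h" if "finite W" "{w. h w \<noteq> 0} \<subseteq> W" for W h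
    using that
  proof (induction W arbitrary: h rule: finite_induct)
    case empty
    then have "h = word_monom 0 []" by (auto simp: word_monom_def)
    then show ?case by (simp add: monom)
  next
    case (insert w W)
    have sub: "{v. (h(w := 0)) v \<noteq> 0} \<subseteq> W" using insert.prems by auto
    then have "h(w := 0) \<in> carrier free_algebra"
      using finite_subset[OF sub insert.hyps(1)] by (simp add: free_algebra_def)
    then have "Q (h(w := 0) \<oplus>\<^bsub>free_algebra\<^esub> word_monom (h w) w)"
      by (intro add monom word_monom_closed insert.IH[OF sub])
    also have "h(w := 0) \<oplus>\<^bsub>free_algebra\<^esub> word_monom (h w) w = h"
      by (auto simp: free_algebra_def word_monom_def)
    finally show ?case .
  qed
  then show ?thesis using f by (auto simp: free_algebra_def)
qed

text \<open>A function \<open>f\<close> on the integers stands for the doubly infinite series \<open>\<Sum> f(n) x\<^sup>n\<close>,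
  on which \<open>x\<close> acts by multiplication and \<open>y\<close> by differentiation.\<close>

fun gen_act :: "weyl_gen \<Rightarrow> (int \<Rightarrow> 'a::field) \<Rightarrow> int \<Rightarrow> 'a" where
  "gen_act Gen_x f = (\<lambda>n. f (n - 1))"
| "gen_act Gen_y f = (\<lambda>n. of_int (n + 1) * f (n + 1))"

text \<open>\<open>foldr\<close> lets the rightmost letter act first, as a left action
  demands.\<close>

definition word_act :: "weyl_gen list \<Rightarrow> (int \<Rightarrow> 'a::field) \<Rightarrow> int \<Rightarrow> 'a" where
  "word_act w f = foldr gen_act w f"

lemma word_act_append: "word_act (u @ v) f = word_act u (word_act v f)"
  by (simp add: word_act_def)

lemma gen_act_scale: "gen_act g (\<lambda>n. k * f n) = (\<lambda>n. k * gen_act g f n)"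
  by (cases g) (auto simp: algebra_simps)

lemma gen_act_add: "gen_act g (\<lambda>n. f n + h n) = (\<lambda>n. gen_act g f n + gen_act g h n)"
  by (cases g) (auto simp: algebra_simps)

lemma word_act_scale: "word_act w (\<lambda>n. k * f n) = (\<lambda>n. k * word_act w f n)"
  by (induction w) (simp_all add: word_act_def gen_act_scale)

lemma word_act_add: "word_act w (\<lambda>n. f n + h n) = (\<lambda>n. word_act w f n + word_act w h n)"
  by (induction w) (simp_all add: word_act_def gen_act_add)

definition free_act :: "(weyl_gen list \<Rightarrow> 'a) \<Rightarrow> (int \<Rightarrow> 'a::field) \<Rightarrow> int \<Rightarrow> 'a" where
  "free_act p f = (\<lambda>n. \<Sum>w | p w \<noteq> 0. p w * word_act w f n)"

text \<open>Allows several elements with different supports to be summed over one common index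
  set.\<close>

lemma free_act_superset:
  assumes "finite W" "{w. p w \<noteq> 0} \<subseteq> W"
  shows "free_act p f n = (\<Sum>w\<in>W. p w * word_act w f n)"
  unfolding free_act_def by (rule sum.mono_neutral_left) (use assms in auto)

lemma free_act_monom: "free_act (word_monom k w) f = (\<lambda>n. k * word_act w f n)"
proof
  fix n
  show "free_act (word_monom k w) f n = k * word_act w f n"
    by (subst free_act_superset[of "{w}"]) (auto simp: word_monom_def)
qed

lemma free_act_add_left:
  assumes "p \<in> carrier free_algebra" "q \<in> carrier free_algebra"
  shows "free_act (p \<oplus>\<^bsub>free_algebra\<^esub> q) f = (\<lambda>n. free_act p f n + free_act q f n)"
proof
  fix n
  define W where "W = {w. p w \<noteq> 0} \<union> {w. q w \<noteq> 0}"
  have W: "finite W" using assms by (auto simp: W_def free_algebra_def)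
  have "free_act r f n = (\<Sum>w\<in>W. r w * word_act w f n)"
    if "r \<in> {p, q, p \<oplus>\<^bsub>free_algebra\<^esub> q}" for r
    using that by (intro free_act_superset W) (auto simp: W_def free_algebra_def)
  then show "free_act (p \<oplus>\<^bsub>free_algebra\<^esub> q) f n = free_act p f n + free_act q f n"
    by (simp add: sum.distrib[symmetric] free_algebra_def algebra_simps)
qed

lemma free_act_add_right:
  "free_act p (\<lambda>n. f n + h n) = (\<lambda>n. free_act p f n + free_act p h n)"
  by (simp add: free_act_def word_act_add sum.distrib algebra_simps)

text \<open>Additivity in \<open>p\<close> and in \<open>q\<close> reduces the claim to monomials,
  where it is \<open>word_act_append\<close>.\<close>

lemma free_act_mult:
  fixes p q :: "weyl_gen list \<Rightarrow> 'a::field"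
  assumes p: "p \<in> carrier free_algebra" and q: "q \<in> carrier free_algebra"
  shows "free_act (p \<otimes>\<^bsub>free_algebra\<^esub> q) f = free_act p (free_act q f)"
proof -
  interpret ring "free_algebra :: (weyl_gen list \<Rightarrow> 'a) ring" by (rule ring_free_algebra)
  have monom: "free_act (word_monom k u \<otimes>\<^bsub>free_algebra\<^esub> q) f =
      free_act (word_monom k u) (free_act q f)" for k u
    using q
  proof (induction q rule: free_algebra_induct)
    case (monom l v)
    show ?case
      by (simp add: word_monom_mult free_act_monom word_act_append word_act_scale mult.assoc)
  next
    case (add q r)
    then show ?case
      by (simp add: r_distr free_act_add_left free_act_add_right)
  qed
  show ?thesis
    using p
  proof (induction p rule: free_algebra_induct)
    case (add p r)
    then show ?case
      using q by (simp add: l_distr free_act_add_left)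
  qed (rule monom)
qed

text \<open>The annihilator of the module of series; as a two-sided ideal containing the relation,
  it lets the action pass to the Weyl algebra.\<close>

definition act_kernel :: "(weyl_gen list \<Rightarrow> 'a::field) set" where
  "act_kernel = {p \<in> carrier free_algebra. \<forall>f. free_act p f = (\<lambda>n. 0)}"

lemma free_act_zero_right:
  fixes p :: "weyl_gen list \<Rightarrow> 'a::field"
  shows "free_act p (\<lambda>n. 0) = (\<lambda>n. 0)"
proof -
  have "word_act w (\<lambda>n. 0) = (\<lambda>n. 0 :: 'a)" for w
    using word_act_scale[of w 0 "\<lambda>n. 0 :: 'a"] by simp
  then show ?thesis by (simp add: free_act_def)
qed

lemma free_act_minus:
  fixes p q :: "weyl_gen list \<Rightarrow> 'a::field"
  assumes "p \<in> carrier free_algebra" "q \<in> carrier free_algebra"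
  shows "free_act (p \<ominus>\<^bsub>free_algebra\<^esub> q) f = (\<lambda>n. free_act p f n - free_act q f n)"
proof -
  interpret ring "free_algebra :: (weyl_gen list \<Rightarrow> 'a) ring" by (rule ring_free_algebra)
  have "(p \<ominus>\<^bsub>free_algebra\<^esub> q) \<oplus>\<^bsub>free_algebra\<^esub> q = p"
    using assms by (simp add: a_minus_def a_assoc l_neg)
  moreover have "free_act ((p \<ominus>\<^bsub>free_algebra\<^esub> q) \<oplus>\<^bsub>free_algebra\<^esub> q) f =
      (\<lambda>n. free_act (p \<ominus>\<^bsub>free_algebra\<^esub> q) f n + free_act q f n)"
    by (rule free_act_add_left) (use assms in auto)
  ultimately show ?thesis by simp
qed

lemma ideal_act_kernel: "ideal (act_kernel :: (weyl_gen list \<Rightarrow> 'a::field) set) free_algebra"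
proof -
  interpret ring "free_algebra :: (weyl_gen list \<Rightarrow> 'a) ring" by (rule ring_free_algebra)
  have zero: "free_act \<zero>\<^bsub>free_algebra\<^esub> f = (\<lambda>n. 0)" for f :: "int \<Rightarrow> 'a"
    by (simp add: free_act_def free_algebra_def)
  show ?thesis
  proof (rule idealI)
    show "ring (free_algebra :: (weyl_gen list \<Rightarrow> 'a) ring)" by (rule ring_axioms)
    show "subgroup act_kernel (add_monoid (free_algebra :: (weyl_gen list \<Rightarrow> 'a) ring))"
    proof (rule add.subgroupI)
      show "(act_kernel :: (weyl_gen list \<Rightarrow> 'a) set) \<noteq> {}"
        using zero by (auto simp: act_kernel_def)
    next
      fix p :: "weyl_gen list \<Rightarrow> 'a" assume p: "p \<in> act_kernel"
      then have "\<ominus>\<^bsub>free_algebra\<^esub> p = \<zero>\<^bsub>free_algebra\<^esub> \<ominus>\<^bsub>free_algebra\<^esub> p"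
        by (simp add: act_kernel_def a_minus_def)
      then show "\<ominus>\<^bsub>free_algebra\<^esub> p \<in> act_kernel"
        using p by (simp add: act_kernel_def free_act_minus zero)
    qed (auto simp: act_kernel_def free_act_add_left)
  qed (auto simp: act_kernel_def free_act_mult free_act_zero_right)
qed

text \<open>On coefficients, \<open>yx\<close> multiplies \<open>f(n)\<close> by
  \<open>n + 1\<close> and \<open>xy\<close> multiplies it by \<open>n\<close>.\<close>

lemma weyl_relation_in_act_kernel: "weyl_relation \<in> act_kernel"
proof -
  interpret ring "free_algebra :: (weyl_gen list \<Rightarrow> 'a) ring" by (rule ring_free_algebra)
  show ?thesis
    by (simp add: act_kernel_def weyl_relation_closed)
       (simp add: weyl_relation_def free_gen_eq_word_monom free_one_eq_word_monom word_monom_mult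
         free_act_minus free_act_monom word_act_def algebra_simps)
qed

subsection \<open>The Weyl algebra\<close>

definition weyl_ideal :: "(weyl_gen list \<Rightarrow> 'a::field) set" where
  "weyl_ideal = Idl\<^bsub>free_algebra\<^esub> {weyl_relation}"

lemma ideal_weyl_ideal: "ideal weyl_ideal free_algebra"
  unfolding weyl_ideal_def
  by (rule ring.genideal_ideal[OF ring_free_algebra]) (simp add: weyl_relation_closed)

lemma weyl_ideal_subset_act_kernel: "weyl_ideal \<subseteq> act_kernel"
  unfolding weyl_ideal_def
  by (rule ring.genideal_minimal[OF ring_free_algebra ideal_act_kernel])
     (simp add: weyl_relation_in_act_kernel)

definition weyl_coset :: "(weyl_gen list \<Rightarrow> 'a::field) \<Rightarrow> (weyl_gen list \<Rightarrow> 'a) set" where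
  "weyl_coset p = weyl_ideal +>\<^bsub>free_algebra\<^esub> p"

lemma weyl_coset_hom: "weyl_coset \<in> ring_hom free_algebra weyl_algebra"
  using ideal.rcos_ring_hom[OF ideal_weyl_ideal]
  by (simp add: weyl_coset_def[abs_def] weyl_algebra_def weyl_ideal_def)

lemma weyl_coset_surj:
  assumes "a \<in> carrier weyl_algebra"
  obtains p where "p \<in> carrier free_algebra" "a = weyl_coset p"
proof -
  have "carrier weyl_algebra = weyl_coset ` carrier free_algebra"
    unfolding weyl_algebra_def weyl_ideal_def[symmetric] weyl_coset_def
    by (auto simp: FactRing_def A_RCOSETS_def RCOSETS_def a_r_coset_def)
  with assms that show thesis by blast
qed

text \<open>Representatives of one coset differ by an element of \<open>weyl_ideal\<close>, which
  acts as zero. Distinct actions therefore separate elements of the Weyl algebra.\<close>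

lemma weyl_coset_eq_imp_act_eq:
  fixes p q :: "weyl_gen list \<Rightarrow> 'a::field"
  assumes "p \<in> carrier free_algebra" "q \<in> carrier free_algebra" "weyl_coset p = weyl_coset q"
  shows "free_act p f = free_act q f"
proof -
  interpret ideal weyl_ideal "free_algebra :: (weyl_gen list \<Rightarrow> 'a) ring"
    by (rule ideal_weyl_ideal)
  have "p \<in> weyl_ideal +>\<^bsub>free_algebra\<^esub> q"
    using a_rcos_self assms unfolding weyl_coset_def by blast
  then obtain r where "r \<in> weyl_ideal" "p = r \<oplus>\<^bsub>free_algebra\<^esub> q"
    by (auto simp: a_r_coset_def')
  then show ?thesis
    using weyl_ideal_subset_act_kernel assms(2)
    by (auto simp: act_kernel_def free_act_add_left)
qed

lemma weyl_coset_relation: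
  "weyl_coset (free_gen Gen_y \<otimes>\<^bsub>free_algebra\<^esub> free_gen Gen_x) =
     (weyl_coset (free_gen Gen_x \<otimes>\<^bsub>free_algebra\<^esub> free_gen Gen_y \<oplus>\<^bsub>free_algebra\<^esub> \<one>\<^bsub>free_algebra\<^esub>)
       :: (weyl_gen list \<Rightarrow> 'a::field) set)"
proof -
  interpret ideal weyl_ideal "free_algebra :: (weyl_gen list \<Rightarrow> 'a) ring"
    by (rule ideal_weyl_ideal)
  let ?yx = "free_gen Gen_y \<otimes>\<^bsub>free_algebra\<^esub> free_gen Gen_x :: weyl_gen list \<Rightarrow> 'a"
  let ?xy = "free_gen Gen_x \<otimes>\<^bsub>free_algebra\<^esub> free_gen Gen_y :: weyl_gen list \<Rightarrow> 'a"
  have rel: "weyl_relation \<in> (weyl_ideal :: (weyl_gen list \<Rightarrow> 'a) set)"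
    unfolding weyl_ideal_def by (rule genideal_self') (rule weyl_relation_closed)
  have "?yx = weyl_relation \<oplus>\<^bsub>free_algebra\<^esub> (?xy \<oplus>\<^bsub>free_algebra\<^esub> \<one>\<^bsub>free_algebra\<^esub>)"
  proof -
    have "a = a \<ominus>\<^bsub>free_algebra\<^esub> b \<ominus>\<^bsub>free_algebra\<^esub> c \<oplus>\<^bsub>free_algebra\<^esub> (b \<oplus>\<^bsub>free_algebra\<^esub> c)"
      if "a \<in> carrier free_algebra" "b \<in> carrier free_algebra" "c \<in> carrier free_algebra"
      for a b c :: "weyl_gen list \<Rightarrow> 'a"
      using that by algebra
    then show ?thesis
      unfolding weyl_relation_def by (simp only: free_gen_closed m_closed one_closed)
  qed
  then have "?yx \<in> weyl_ideal +>\<^bsub>free_algebra\<^esub> (?xy \<oplus>\<^bsub>free_algebra\<^esub> \<one>\<^bsub>free_algebra\<^esub>)"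
    using rel unfolding a_r_coset_def' by blast
  then show ?thesis
    unfolding weyl_coset_def
    by (intro a_repr_independence'[symmetric]) (simp_all add: free_gen_closed)
qed

interpretation weyl: weyl_ring "weyl_algebra :: (weyl_gen list \<Rightarrow> 'a::field_char_0) set ring"
  "\<lambda>k. weyl_coset (word_monom k [])" "weyl_coset (free_gen Gen_x)" "weyl_coset (free_gen Gen_y)"
proof -
  interpret W: ring "weyl_algebra :: (weyl_gen list \<Rightarrow> 'a) set ring" by (rule ring_weyl_algebra)
  interpret F: ring "free_algebra :: (weyl_gen list \<Rightarrow> 'a) ring" by (rule ring_free_algebra)
  note hom = weyl_coset_hom[where 'a = 'a]
  note simps = ring_hom_mult[OF hom, symmetric] ring_hom_add[OF hom, symmetric]
    ring_hom_one[OF hom, symmetric] free_gen_closed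
  show "weyl_ring (weyl_algebra :: (weyl_gen list \<Rightarrow> 'a) set ring)
    (\<lambda>k. weyl_coset (word_monom k [])) (weyl_coset (free_gen Gen_x)) (weyl_coset (free_gen Gen_y))"
  proof
    fix a :: "(weyl_gen list \<Rightarrow> 'a) set" and k
    assume "a \<in> carrier weyl_algebra"
    then obtain p where "p \<in> carrier free_algebra" "a = weyl_coset p" by (rule weyl_coset_surj)
    then show "weyl_coset (word_monom k []) \<otimes>\<^bsub>weyl_algebra\<^esub> a =
        a \<otimes>\<^bsub>weyl_algebra\<^esub> weyl_coset (word_monom k [])"
      by (simp add: simps word_monom_Nil_mult_left word_monom_Nil_mult_right)
  next
    fix S :: "(weyl_gen list \<Rightarrow> 'a) set set"
    assume c: "\<And>k. weyl_coset (word_monom k []) \<in> S"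
      and add: "\<And>a b. a \<in> S \<Longrightarrow> b \<in> S \<Longrightarrow> a \<oplus>\<^bsub>weyl_algebra\<^esub> b \<in> S"
      and x: "\<And>a. a \<in> S \<Longrightarrow> weyl_coset (free_gen Gen_x) \<otimes>\<^bsub>weyl_algebra\<^esub> a \<in> S"
      and y: "\<And>a. a \<in> S \<Longrightarrow> weyl_coset (free_gen Gen_y) \<otimes>\<^bsub>weyl_algebra\<^esub> a \<in> S"
    \<comment> \<open>Two inductions: over sums of monomials, then over the letters of a word,
      starting from the scalar on the empty word.\<close>
    have "weyl_coset p \<in> S" if "p \<in> carrier free_algebra" for p
      using that
    proof (induction p rule: free_algebra_induct)
      case (monom k w)
      show ?case
      proof (induction w)
        case (Cons g w)
        have "weyl_coset (word_monom k (g # w)) =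
            weyl_coset (free_gen g) \<otimes>\<^bsub>weyl_algebra\<^esub> weyl_coset (word_monom k w)"
          by (simp add: simps) (simp add: free_gen_eq_word_monom word_monom_mult)
        then show ?case using Cons x y by (cases g) auto
      qed (rule c)
    next
      case (add p q)
      then show ?case
        by (simp add: ring_hom_add[OF hom] \<open>\<And>a b. a \<in> S \<Longrightarrow> b \<in> S \<Longrightarrow> a \<oplus>\<^bsub>weyl_algebra\<^esub> b \<in> S\<close>)
    qed
    then show "carrier weyl_algebra \<subseteq> S"
      by (auto elim!: weyl_coset_surj)
  next
    show "weyl_coset (free_gen Gen_y) \<otimes>\<^bsub>weyl_algebra\<^esub> weyl_coset (free_gen Gen_x) =
        weyl_coset (free_gen Gen_x) \<otimes>\<^bsub>weyl_algebra\<^esub> weyl_coset (free_gen Gen_y)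
          \<oplus>\<^bsub>weyl_algebra\<^esub> (\<one>\<^bsub>weyl_algebra\<^esub> :: (weyl_gen list \<Rightarrow> 'a) set)"
      by (simp add: simps weyl_coset_relation)
  next
    fix k l :: 'a
    show "weyl_coset (word_monom (k + l) []) = weyl_coset (word_monom k [])
        \<oplus>\<^bsub>weyl_algebra\<^esub> (weyl_coset (word_monom l []) :: (weyl_gen list \<Rightarrow> 'a) set)"
      by (simp add: simps word_monom_add)
    show "weyl_coset (word_monom (k * l) []) = weyl_coset (word_monom k [])
        \<otimes>\<^bsub>weyl_algebra\<^esub> (weyl_coset (word_monom l []) :: (weyl_gen list \<Rightarrow> 'a) set)"
      by (simp add: simps word_monom_mult)
  next
    show "weyl_coset (word_monom 1 []) = (\<one>\<^bsub>weyl_algebra\<^esub> :: (weyl_gen list \<Rightarrow> 'a) set)"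
      by (simp add: ring_hom_one[OF hom, symmetric] free_one_eq_word_monom)
  qed (simp_all add: ring_hom_closed[OF hom] free_gen_closed)
qed

text \<open>Apply both sides to the series \<open>x\<^sup>-\<^sup>1\<close>, which \<open>yx\<close> annihilates and \<open>x\<close> does not.\<close>

lemma x_neq_mult_yx:
  fixes b :: "(weyl_gen list \<Rightarrow> 'a::field) set"
  assumes "b \<in> carrier weyl_algebra"
  shows "weyl_coset (free_gen Gen_x) \<noteq> b \<otimes>\<^bsub>weyl_algebra\<^esub>
    (weyl_coset (free_gen Gen_y) \<otimes>\<^bsub>weyl_algebra\<^esub> weyl_coset (free_gen Gen_x))"
proof
  interpret F: ring "free_algebra :: (weyl_gen list \<Rightarrow> 'a) ring" by (rule ring_free_algebra)
  let ?x = "free_gen Gen_x :: weyl_gen list \<Rightarrow> 'a"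
  let ?yx = "free_gen Gen_y \<otimes>\<^bsub>free_algebra\<^esub> free_gen Gen_x :: weyl_gen list \<Rightarrow> 'a"
  note hom = weyl_coset_hom[where 'a = 'a]
  obtain p where p: "p \<in> carrier free_algebra" "b = weyl_coset p"
    using assms by (rule weyl_coset_surj)
  assume "weyl_coset ?x = b \<otimes>\<^bsub>weyl_algebra\<^esub>
    (weyl_coset (free_gen Gen_y) \<otimes>\<^bsub>weyl_algebra\<^esub> weyl_coset ?x)"
  then have eq: "weyl_coset ?x = weyl_coset (p \<otimes>\<^bsub>free_algebra\<^esub> ?yx)"
    using p by (simp add: ring_hom_mult[OF hom] free_gen_closed)
  define f :: "int \<Rightarrow> 'a" where "f = (\<lambda>n. if n = - 1 then 1 else 0)"
  have "free_act ?x f = free_act p (free_act ?yx f)"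
    using weyl_coset_eq_imp_act_eq[OF _ _ eq] p
    by (simp add: free_act_mult free_gen_closed)
  also have "free_act ?yx f = (\<lambda>n. 0)"
  proof
    fix n
    show "free_act ?yx f n = 0"
      \<comment> \<open>At \<open>n = - 1\<close> the factor \<open>n + 1\<close> vanishes;
        elsewhere \<open>f n\<close> does.\<close>
      by (cases "n = - 1")
        (auto simp: free_gen_eq_word_monom word_monom_mult free_act_monom word_act_def f_def)
  qed
  \<comment> \<open>Index 0 is where \<open>x\<close> times the inverse of \<open>x\<close> has its
    coefficient 1.\<close>
  finally have "free_act ?x f 0 = 0"
    by (simp add: free_act_zero_right)
  then show False
    by (simp add: free_gen_eq_word_monom free_act_monom word_act_def f_def)
qed

theorem theorem7:
  shows "\<not> weakly_left_jacobson
           (weyl_algebra :: (weyl_gen list \<Rightarrow> 'a::field_char_0) set ring)"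
  by (rule weyl.not_weakly_left_jacobson) (rule x_neq_mult_yx)

end
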